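(* Let $f,g:\mathbb{R}^n\to\mathbb{R}^n$ be of class $C^2$ and suppose there are constants $\mu\in\mathbb{R}$, $c>0$ and $\sigma$ such that for all $x,y\in\mathbb{R}^n$ $$\langle x-y,f(x)-f(y)\rangle\le\mu|x-y|^2,\qquad |g(x)-g(y)|^2\le c|x-y|^2,\qquad |L^1g(x)-L^1g(y)|^2\le\sigma|x-y|^2 .$$ Put $\beta:=\max\{\mu+\tfrac12,\,2c\}$. Let $\theta\in[1/2,1]$, $T>0$ and $x_0\in\mathbb{R}^n$. Then for each $p\ge 2$ there is a constant $C>0$, independent of the stepsize $\Delta$, such that for every stepsize $\Delta=T/N$ ($N$ a positive integer) with $\Delta<\Delta^*:=1/(2\theta\beta)$, the split-step theta-Milstein approximation $\{z_k\}$ and the stochastic theta-Milstein approximation $\{y_k\}$ with initial value $y_0=x_0$ satisfy $$\mathbb{E}\Big[\sup_{k\Delta\in[0,T]}|z_k|^p\Big]\le C\qquad\text{and}\qquad \mathbb{E}\Big[\sup_{k\Delta\in[0,T]}|y_k|^p\Big]\le C .$$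
   Context: $|\cdot|$ is the Euclidean norm and $\langle x,y\rangle=x^Ty$ on $\mathbb{R}^n$. $(w(t))_{t\ge0}$ is a one-dimensional Brownian motion on a complete filtered probability space $(\Omega,\mathfrak{F},\{\mathfrak{F}_t\}_{t\ge0},\mathbb{P})$ satisfying the usual conditions. The underlying SDE is $dx(t)=f(x(t))dt+g(x(t))dw(t)$, $x(0)=x_0\in\mathbb{R}^n$. Here $L^1=g(x)\frac{\partial}{\partial x}$, i.e. $L^1g(x)=g'(x)g(x)=\sum_{i=1}^n g^i(x)\frac{\partial g}{\partial x^i}(x)\in\mathbb{R}^n$. For $\theta\in[0,1]$, a stepsize $\Delta$ with $\theta\mu\Delta<1$ and $\Delta w_k:=w((k+1)\Delta)-w(k\Delta)$, set $y_0=x_0$, $z_0=y_0-\theta f(y_0)\Delta$ and, for $k=0,1,2,\dots$, $$z_{k+1}=z_k+f(y_k)\Delta+g(y_k)\Delta w_k+\tfrac12L^1g(y_k)\big(|\Delta w_k|^2-\Delta\big),\qquad y_{k}=z_{k}+\theta f(y_{k})\Delta,$$ where, for each $k$, $y_k$ is the unique solution $y$ of $y=z_k+\theta\Delta f(y)$ (uniquely solvable by the one-sided Lipschitz condition on $f$ and $\theta\mu\Delta<1$). $\{z_k\}$ is called the split-step theta-Milstein (SSTM) approximation and $\{y_k\}$ the stochastic theta-Milstein (STM) approximation. *)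

theory Defs
  imports "HOL-Probability.Probability"
begin

definition class_C2 :: "('a::real_normed_vector \<Rightarrow> 'b::real_normed_vector) \<Rightarrow> bool" where
  "class_C2 f \<longleftrightarrow>
    (\<exists>(f' :: 'a \<Rightarrow> 'a \<Rightarrow>\<^sub>L 'b) (f'' :: 'a \<Rightarrow> 'a \<Rightarrow>\<^sub>L 'a \<Rightarrow>\<^sub>L 'b).
      (\<forall>x. (f has_derivative blinfun_apply (f' x)) (at x)) \<and>
      (\<forall>x. (f' has_derivative blinfun_apply (f'' x)) (at x)) \<and>
      continuous_on UNIV f'')"

text \<open>The operator \<open>L1 = g(x) d/dx\<close> applied to \<open>h\<close>: the derivative of \<open>h\<close> at \<open>x\<close> in the
  direction \<open>g x\<close>. The coordinate formula is \<open>L1_sum\<close> below.\<close>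

definition L1 :: "(real ^ 'n \<Rightarrow> real ^ 'n) \<Rightarrow> (real ^ 'n \<Rightarrow> real ^ 'n) \<Rightarrow> real ^ 'n \<Rightarrow> real ^ 'n" where
  "L1 g h x = frechet_derivative h (at x) (g x)"

lemma L1_sum:
  fixes g h :: "real ^ 'n \<Rightarrow> real ^ 'n"
  assumes "h differentiable (at x)"
  shows "L1 g h x = (\<Sum>i\<in>UNIV. (g x $ i) *\<^sub>R frechet_derivative h (at x) (axis i 1))"
proof -
  have lin: "linear (frechet_derivative h (at x))"
    using assms by (rule linear_frechet_derivative)
  have "L1 g h x = frechet_derivative h (at x) (\<Sum>i\<in>UNIV. (g x $ i) *\<^sub>R axis i 1)"
    unfolding L1_def by (simp add: basis_expansion flip: scalar_mult_eq_scaleR)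
  then show ?thesis
    by (simp add: linear_sum[OF lin] linear_cmul[OF lin])
qed

text \<open>A complete filtered probability space satisfying the usual conditions. Time is the
  half-line \<open>t \<ge> 0\<close>; the values of \<open>F\<close> at negative reals are irrelevant.\<close>

locale usual_filtered_prob_space = prob_space M + complete_measure M
  for M :: "'a measure" +
  fixes F :: "real \<Rightarrow> 'a measure"
  assumes sub: "\<And>t. 0 \<le> t \<Longrightarrow> subalgebra M (F t)"
    and mono: "\<And>s t. 0 \<le> s \<Longrightarrow> s \<le> t \<Longrightarrow> sets (F s) \<subseteq> sets (F t)"
    and right_continuous: "\<And>t. 0 \<le> t \<Longrightarrow> sets (F t) = (\<Inter>s\<in>{t<..}. sets (F s))"
    and null_sets_initial: "null_sets M \<subseteq> sets (F 0)"

locale brownian_motion = usual_filtered_prob_space M F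
  for M :: "'a measure" and F :: "real \<Rightarrow> 'a measure" +
  fixes w :: "real \<Rightarrow> 'a \<Rightarrow> real"
  assumes adapted: "\<And>t. 0 \<le> t \<Longrightarrow> w t \<in> borel_measurable (F t)"
    and start: "AE \<omega> in M. w 0 \<omega> = 0"
    and continuous_paths: "AE \<omega> in M. continuous_on {0..} (\<lambda>t. w t \<omega>)"
    and increment_normal: "\<And>s t. 0 \<le> s \<Longrightarrow> s < t \<Longrightarrow>
      distributed M lborel (\<lambda>\<omega>. w t \<omega> - w s \<omega>) (normal_density 0 (sqrt (t - s)))"
    and increment_indep: "\<And>s t. 0 \<le> s \<Longrightarrow> s < t \<Longrightarrow>
      indep_set (sets (F s)) (sets (vimage_algebra (space M) (\<lambda>\<omega>. w t \<omega> - w s \<omega>) borel))"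

text \<open>The two Milstein approximations \<open>z_k\<close> (\<open>sstm\<close>) and \<open>y_k\<close> (\<open>stm\<close>) with stepsize \<open>d\<close>. The
  description operator denotes the solution of the implicit equation only where that solution
  exists and is unique, as it does when \<open>f\<close> is continuous and one-sided Lipschitz with constant
  \<open>\<mu>\<close> and \<open>\<theta> * \<mu> * d < 1\<close>; in that case \<open>y_0 = x0\<close> also solves the equation for \<open>k = 0\<close>.\<close>

fun sstm stm ::
  "(real ^ 'n \<Rightarrow> real ^ 'n) \<Rightarrow> (real ^ 'n \<Rightarrow> real ^ 'n) \<Rightarrow> real \<Rightarrow> (real \<Rightarrow> 'a \<Rightarrow> real) \<Rightarrow>
   real ^ 'n \<Rightarrow> real \<Rightarrow> nat \<Rightarrow> 'a \<Rightarrow> real ^ 'n"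
where
  "sstm f g \<theta> w x0 d 0 \<omega> = x0 - (\<theta> * d) *\<^sub>R f x0"
| "sstm f g \<theta> w x0 d (Suc k) \<omega> =
    (let z = sstm f g \<theta> w x0 d k \<omega>;
         y = stm f g \<theta> w x0 d k \<omega>;
         dw = w (real (k + 1) * d) \<omega> - w (real k * d) \<omega>
     in z + d *\<^sub>R f y + dw *\<^sub>R g y + ((\<bar>dw\<bar>\<^sup>2 - d) / 2) *\<^sub>R L1 g g y)"
| "stm f g \<theta> w x0 d 0 \<omega> = x0"
| "stm f g \<theta> w x0 d (Suc k) \<omega> =
    (THE y. y = sstm f g \<theta> w x0 d (Suc k) \<omega> + (\<theta> * d) *\<^sub>R f y)"

end

theory Submission
  imports Defs
begin

text \<open>
  Write \<open>y = H z\<close> for the solution of \<open>y = z + \<theta> \<Delta> f y\<close>; the one-sided Lipschitz condition and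
  \<open>\<theta> \<mu> \<Delta> < 1/2\<close> make \<open>H\<close> 2-Lipschitz, uniformly in the stepsize, so \<open>z\<close> is a Markov chain and \<open>y\<close> grows at
  most linearly in \<open>z\<close>. For \<open>V = 1 + |z|\<^sup>2\<close>, the condition \<open>\<theta> \<ge> 1/2\<close> makes the contribution of
  \<open>\<Delta>\<^sup>2 |f y|\<^sup>2\<close> nonpositive, and with \<open>\<Delta>w = sqrt \<Delta> \<eta>\<close> one step multiplies \<open>V\<close> by at most
  \<open>1 + a sqrt \<Delta> \<eta> + K \<Delta> (1 + \<eta>\<^sup>4)\<close> with \<open>|a| \<le> K\<close>. Since \<open>\<eta>\<close> is standard normal and independent of the
  past, \<open>U = V ^ (2 q)\<close> satisfies \<open>E (U' | past) \<le> (1 + C \<Delta>) U\<close>. A maximal inequality for such nonnegative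
  processes bounds the expectation of the maximum of \<open>sqrt U = V ^ q\<close>, and \<open>V ^ q\<close> dominates
  \<open>|z| powr p\<close> for \<open>q \<ge> p / 2\<close>.
\<close>


section \<open>The resolvent of the one-sided Lipschitz drift\<close>

text \<open>After pairing the difference of the two images with \<open>x - y\<close>, the drift
  costs at most half of the squared distance, which the left side absorbs; Cauchy-Schwarz handles
  the rest. The factor 2 is free of \<open>h\<close>, hence uniform in the stepsize.\<close>

lemma one_sided_Lipschitz_resolvent_expanding:
  fixes f :: "'a::real_inner \<Rightarrow> 'a"
  assumes mono: "\<And>x y. (x - y) \<bullet> (f x - f y) \<le> \<mu> * (norm (x - y))\<^sup>2"
    and h: "0 \<le> h" "h * \<mu> \<le> 1/2"
  shows "norm (x - y) \<le> 2 * norm ((x - h *\<^sub>R f x) - (y - h *\<^sub>R f y))"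
proof -
  let ?d = "(x - h *\<^sub>R f x) - (y - h *\<^sub>R f y)"
  have "(norm (x - y))\<^sup>2 = (x - y) \<bullet> ?d + h * ((x - y) \<bullet> (f x - f y))"
    by (simp add: power2_norm_eq_inner algebra_simps)
  also have "\<dots> \<le> (x - y) \<bullet> ?d + h * (\<mu> * (norm (x - y))\<^sup>2)"
    by (intro add_left_mono mult_left_mono mono h)
  also have "\<dots> \<le> norm (x - y) * norm ?d + 1/2 * (norm (x - y))\<^sup>2"
    using mult_right_mono[OF h(2), of "(norm (x - y))\<^sup>2"]
    by (intro add_mono norm_cauchy_schwarz) (simp add: mult.assoc)
  finally have "norm (x - y) * norm (x - y) \<le> norm (x - y) * (2 * norm ?d)"
    by (simp add: power2_eq_square)
  then show ?thesis
    by (cases "x = y") auto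
qed

text \<open>The map \<open>x - h f x\<close> is injective with a Lipschitz inverse, hence closed, and open by
  invariance of domain; its range is therefore clopen.\<close>

lemma one_sided_Lipschitz_resolvent_surj:
  fixes f :: "'a::euclidean_space \<Rightarrow> 'a"
  assumes mono: "\<And>x y. (x - y) \<bullet> (f x - f y) \<le> \<mu> * (norm (x - y))\<^sup>2"
    and h: "0 \<le> h" "h * \<mu> \<le> 1/2"
    and cont: "continuous_on UNIV f"
  shows "surj (\<lambda>x. x - h *\<^sub>R f x)"
proof -
  let ?G = "\<lambda>x. x - h *\<^sub>R f x"
  have exp: "norm (x - y) \<le> 2 * norm (?G x - ?G y)" for x y
    using mono h by (rule one_sided_Lipschitz_resolvent_expanding)
  have contG: "continuous_on UNIV ?G"
    by (intro continuous_intros cont)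
  have "inj ?G"
  proof (rule injI)
    fix x y assume "?G x = ?G y"
    then show "x = y" using exp[of x y] by simp
  qed
  then have op: "open (range ?G)"
    using contG by (intro invariance_of_domain) auto
  have "closed (range ?G)"
  proof (rule closed_sequential_limits[THEN iffD2], intro allI impI, elim conjE)
    fix u l assume u: "\<forall>n. u n \<in> range ?G" and l: "u \<longlonglongrightarrow> l"
    from u obtain v where v: "\<And>n. u n = ?G (v n)" unfolding image_iff by metis
    have "Cauchy v"
    proof (rule metric_CauchyI)
      fix e :: real assume "0 < e"
      then obtain N where N: "\<And>m n. N \<le> m \<Longrightarrow> N \<le> n \<Longrightarrow> dist (u m) (u n) < e / 2"
        using LIMSEQ_imp_Cauchy[OF l] metric_CauchyD[of u "e / 2"] by auto
      have "dist (v m) (v n) < e" if "N \<le> m" "N \<le> n" for m n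
        using N[OF that] exp[of "v m" "v n"] by (simp add: v dist_norm)
      then show "\<exists>N. \<forall>m\<ge>N. \<forall>n\<ge>N. dist (v m) (v n) < e" by blast
    qed
    then obtain x where "v \<longlonglongrightarrow> x" using Cauchy_convergent convergent_def by blast
    then have "u \<longlonglongrightarrow> ?G x"
      using contG unfolding v continuous_on_eq_continuous_at[OF open_UNIV] by (auto intro: isCont_tendsto_compose)
    then show "l \<in> range ?G" using LIMSEQ_unique[OF l] by blast
  qed
  with op have "range ?G = {} \<or> range ?G = UNIV"
    using clopen[of "range ?G"] by blast
  then show ?thesis by auto
qed

section \<open>Growth of the squared norm over one Milstein step\<close>

text \<open>Here \<open>s\<close> is the square root of the stepsize and \<open>\<eta>\<close> the
  normalised increment. Only the cross term of drift and diffusion has order \<open>s\<close>; it is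
  kept exactly as \<open>a * s * \<eta>\<close>, because it will vanish in the mean, whereas
  bounding it by its absolute value would lose a factor \<open>s\<close>. All other terms have order
  \<open>s\<^sup>2\<close> and go into \<open>K\<close>.\<close>

lemma milstein_step_growth:
  fixes y z fy g l :: "'a::real_inner"
  assumes \<theta>: "1/2 \<le> \<theta>" and s: "0 \<le> s" "s\<^sup>2 \<le> T"
    and z: "z = y - (\<theta> * s\<^sup>2) *\<^sub>R fy"
    and nonneg: "0 \<le> D" "0 \<le> G" "0 \<le> \<Lambda>"
    and D: "2 * (y \<bullet> fy) \<le> D * (1 + (norm z)\<^sup>2)"
    and G: "norm g \<le> G * sqrt (1 + (norm z)\<^sup>2)"
    and \<Lambda>: "norm l \<le> \<Lambda> * sqrt (1 + (norm z)\<^sup>2)"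
    and K: "K = D + 2 * (1 + T * D) * G + (1 + T * D) * \<Lambda> + 2 * G\<^sup>2 + T * \<Lambda>\<^sup>2"
  shows "\<exists>a. \<bar>a\<bar> \<le> K \<and> (\<forall>\<eta>.
    1 + (norm (z + s\<^sup>2 *\<^sub>R fy + (s * \<eta>) *\<^sub>R g + (((s * \<eta>)\<^sup>2 - s\<^sup>2) / 2) *\<^sub>R l))\<^sup>2
      \<le> (1 + (norm z)\<^sup>2) * (1 + a * s * \<eta> + K * s\<^sup>2 * (1 + \<eta>^4)))"
proof -
  define V where "V = 1 + (norm z)\<^sup>2"
  define v where "v = sqrt V"
  define A where "A = z + s\<^sup>2 *\<^sub>R fy"
  define E where "E = 1 + T * D"
  have T: "0 \<le> T" using s(2) by (meson order_trans zero_le_power2)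
  have E1: "1 \<le> E" using T nonneg by (simp add: E_def)
  have V1: "1 \<le> V" and v2: "v\<^sup>2 = V" and v1: "1 \<le> v"
    by (auto simp: V_def v_def)
  have A_le: "(norm A)\<^sup>2 \<le> (norm z)\<^sup>2 + s\<^sup>2 * D * V"
  proof -
    \<comment> \<open>Trading \<open>z\<close> for \<open>y\<close> in the inner product with
      \<open>fy\<close> costs \<open>2 * \<theta> * (s\<^sup>2)\<^sup>2 * (norm fy)\<^sup>2\<close>,
      which compensates the square of the drift increment when \<open>\<theta> \<ge> 1/2\<close>. So
      \<open>fy\<close> itself may grow superlinearly.\<close>
    have "(norm A)\<^sup>2 = (norm z)\<^sup>2 + s\<^sup>2 * (2 * (y \<bullet> fy)) + (1 - 2 * \<theta>) * (s\<^sup>2)\<^sup>2 * (norm fy)\<^sup>2"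
      unfolding A_def z power2_norm_eq_inner
      by (simp add: algebra_simps inner_commute power2_eq_square)
    also have "\<dots> \<le> (norm z)\<^sup>2 + s\<^sup>2 * (D * V) + 0"
      using \<theta> D by (intro add_mono mult_left_mono mult_nonpos_nonneg order_refl) (auto simp: V_def)
    finally show ?thesis by simp
  qed
  have "s\<^sup>2 * D * V \<le> T * D * V"
    using s nonneg V1 by (intro mult_right_mono) auto
  with A_le have "(norm A)\<^sup>2 \<le> V * E"
    by (simp add: E_def V_def algebra_simps)
  \<comment> \<open>Since \<open>1 \<le> E\<close>, passing to \<open>E\<^sup>2\<close> is allowed;
    it keeps a root of \<open>E\<close> out of \<open>nA\<close>.\<close>
  also have "\<dots> \<le> V * E\<^sup>2"
    using E1 V1 by (intro mult_left_mono) (auto simp: power2_eq_square)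
  also have "\<dots> = (v * E)\<^sup>2" by (simp add: v2 power_mult_distrib)
  finally have nA: "norm A \<le> v * E"
    using v1 E1 by (meson power2_le_imp_le mult_nonneg_nonneg order_trans zero_le_one)
  have ng: "norm g \<le> G * v" and nl: "norm l \<le> \<Lambda> * v"
    using G \<Lambda> by (auto simp: v_def V_def)
  have Ag: "\<bar>A \<bullet> g\<bar> \<le> E * G * V"
  proof -
    have "\<bar>A \<bullet> g\<bar> \<le> norm A * norm g" by (rule Cauchy_Schwarz_ineq2)
    also have "\<dots> \<le> (v * E) * (G * v)"
      using nA ng E1 v1 by (intro mult_mono) auto
    finally show ?thesis by (simp add: v2[symmetric] power2_eq_square mult_ac)
  qed
  have Al: "\<bar>A \<bullet> l\<bar> \<le> E * \<Lambda> * V"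
  proof -
    have "\<bar>A \<bullet> l\<bar> \<le> norm A * norm l" by (rule Cauchy_Schwarz_ineq2)
    also have "\<dots> \<le> (v * E) * (\<Lambda> * v)"
      using nA nl E1 v1 by (intro mult_mono) auto
    finally show ?thesis by (simp add: v2[symmetric] power2_eq_square mult_ac)
  qed
  have g2: "(norm g)\<^sup>2 \<le> G\<^sup>2 * V" and l2: "(norm l)\<^sup>2 \<le> \<Lambda>\<^sup>2 * V"
    using power_mono[OF ng, of 2] power_mono[OF nl, of 2] by (auto simp: power_mult_distrib v2)
  \<comment> \<open>\<open>a\<close> depends on \<open>z\<close> but not on \<open>\<eta>\<close>;
    dividing by \<open>V\<close> makes its bound uniform in \<open>z\<close>.\<close>
  define a where "a = 2 * (A \<bullet> g) / V"
  have K': "K = D + 2 * E * G + E * \<Lambda> + 2 * G\<^sup>2 + T * \<Lambda>\<^sup>2"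
    by (simp add: K E_def)
  have "\<bar>a\<bar> \<le> 2 * E * G"
    using Ag V1 by (simp add: a_def abs_mult field_simps)
  also have "\<dots> \<le> K"
    using nonneg E1 T by (simp add: K')
  finally have a: "\<bar>a\<bar> \<le> K" .
  have "1 + (norm (A + (s * \<eta>) *\<^sub>R g + (((s * \<eta>)\<^sup>2 - s\<^sup>2) / 2) *\<^sub>R l))\<^sup>2
      \<le> V * (1 + a * s * \<eta> + K * s\<^sup>2 * (1 + \<eta>^4))" for \<eta>
  proof -
    \<comment> \<open>\<open>q\<close> dominates every polynomial in \<open>\<eta>\<close> that
      occurs besides the linear one, so a single expression carries all terms of order
      \<open>s\<^sup>2\<close>.\<close>
    define q where "q = 1 + \<eta>^4"
    have q: "1 \<le> q" "\<eta>\<^sup>2 \<le> q" "\<bar>\<eta>\<^sup>2 - 1\<bar> \<le> q" "(\<eta>\<^sup>2 - 1)\<^sup>2 \<le> q"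
    proof -
      have e: "\<eta>^4 = \<eta>\<^sup>2 * \<eta>\<^sup>2" by (simp add: power4_eq_xxxx power2_eq_square)
      have *: "0 \<le> (\<eta>\<^sup>2 - 1)\<^sup>2" "0 \<le> \<eta>\<^sup>2 * \<eta>\<^sup>2" "0 \<le> \<eta>\<^sup>2" by auto
      show "1 \<le> q" "(\<eta>\<^sup>2 - 1)\<^sup>2 \<le> q" using * unfolding q_def e power2_eq_square[of "\<eta>\<^sup>2 - 1"]
        by (auto simp: algebra_simps)
      show "\<eta>\<^sup>2 \<le> q" using * unfolding q_def e power2_eq_square[of "\<eta>\<^sup>2 - 1"] left_diff_distrib right_diff_distrib
        by linarith
      then show "\<bar>\<eta>\<^sup>2 - 1\<bar> \<le> q"  using * unfolding q_def e
        by linarith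
    qed
    define M1 where "M1 = (s * \<eta>) *\<^sub>R g"
    define M2 where "M2 = (((s * \<eta>)\<^sup>2 - s\<^sup>2) / 2) *\<^sub>R l"
    have m2: "((s * \<eta>)\<^sup>2 - s\<^sup>2) / 2 = s\<^sup>2 * (\<eta>\<^sup>2 - 1) / 2"
      by (simp add: power_mult_distrib algebra_simps)
    have sq: "(norm (M1 + M2))\<^sup>2 \<le> 2 * (norm M1)\<^sup>2 + 2 * (norm M2)\<^sup>2"
    proof -
      have "0 \<le> (norm (M1 - M2))\<^sup>2" by simp
      then show ?thesis
        unfolding power2_norm_eq_inner by (simp add: algebra_simps inner_commute)
    qed
    have b1: "2 * (norm M1)\<^sup>2 \<le> 2 * G\<^sup>2 * V * s\<^sup>2 * q"
    proof -
      have "(norm M1)\<^sup>2 = s\<^sup>2 * (\<eta>\<^sup>2 * (norm g)\<^sup>2)" by (simp add: M1_def power_mult_distrib)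
      also have "\<dots> \<le> s\<^sup>2 * (q * (G\<^sup>2 * V))"
        using q g2 by (intro mult_left_mono mult_mono) auto
      finally show ?thesis by (simp add: mult_ac)
    qed
    have b2: "2 * (norm M2)\<^sup>2 \<le> T * \<Lambda>\<^sup>2 * V * s\<^sup>2 * q"
    proof -
      have "2 * (norm M2)\<^sup>2 = (1/2) * (s\<^sup>2 * (s\<^sup>2 * ((\<eta>\<^sup>2 - 1)\<^sup>2 * (norm l)\<^sup>2)))"
        unfolding M2_def m2 by (simp add: power_mult_distrib power_divide)
      also have "\<dots> \<le> 1 * (s\<^sup>2 * (T * (q * (\<Lambda>\<^sup>2 * V))))"
        using q l2 s T V1 by (intro mult_mono mult_nonneg_nonneg) auto
      finally show ?thesis by (simp add: mult_ac)
    qed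
    have b3: "2 * (A \<bullet> M2) \<le> E * \<Lambda> * V * s\<^sup>2 * q"
    proof -
      have "2 * (A \<bullet> M2) = s\<^sup>2 * ((\<eta>\<^sup>2 - 1) * (A \<bullet> l))" by (simp add: M2_def m2)
      also have "\<dots> \<le> s\<^sup>2 * (\<bar>\<eta>\<^sup>2 - 1\<bar> * \<bar>A \<bullet> l\<bar>)"
        by (intro mult_left_mono) (auto simp flip: abs_mult)
      also have "\<dots> \<le> s\<^sup>2 * (q * (E * \<Lambda> * V))"
        using q Al by (intro mult_left_mono mult_mono) auto
      finally show ?thesis by (simp add: mult_ac)
    qed
    have b4: "2 * (A \<bullet> M1) = V * a * s * \<eta>"
      using V1 by (simp add: M1_def a_def)
    have b5: "s\<^sup>2 * D * V \<le> D * V * s\<^sup>2 * q"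
      using q(1) nonneg V1 mult_left_mono[of 1 q "D * V * s\<^sup>2"] by (simp add: mult_ac)
    \<comment> \<open>The summand \<open>2 * E * G\<close> of \<open>K\<close> serves to bound
      \<open>a\<close>; in the sum below it is nonnegative slack.\<close>
    have b6: "0 \<le> E * G * V * s\<^sup>2 * q"
      using E1 nonneg V1 q by auto
    have "1 + (norm (A + M1 + M2))\<^sup>2 = 1 + (norm A)\<^sup>2 + 2 * (A \<bullet> M1) + 2 * (A \<bullet> M2) + (norm (M1 + M2))\<^sup>2"
      unfolding power2_norm_eq_inner by (simp add: algebra_simps inner_commute)
    also have "\<dots> \<le> (V + D * V * s\<^sup>2 * q) + V * a * s * \<eta> + E * \<Lambda> * V * s\<^sup>2 * q + 
       (2 * G\<^sup>2 * V * s\<^sup>2 * q + T * \<Lambda>\<^sup>2 * V * s\<^sup>2 * q)"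
      using A_le sq b1 b2 b3 b4 b5 unfolding V_def by linarith
    also have "\<dots> \<le> V * (1 + a * s * \<eta> + K * s\<^sup>2 * q)"
      using b6 unfolding K' by (simp add: algebra_simps)
    finally show ?thesis by (simp add: q_def M1_def M2_def)
  qed
  with a show ?thesis by (auto simp: A_def V_def)
qed

section \<open>Powers and moments of the growth factor\<close>

text \<open>Passing from \<open>m\<close> to \<open>m + 1\<close> multiplies the remainder by
  \<open>1 + x\<close> and adds \<open>m * x\<^sup>2\<close>; the coefficients fit because
  \<open>m\<^sup>2 + m \<le> (m + 1)\<^sup>2\<close>. The power of \<open>1 + \<bar>x\<bar>\<close>
  allows \<open>x\<close> of any sign and size.\<close>

lemma power_first_order_bound:
  fixes x :: real
  shows "\<bar>(1 + x) ^ m - 1 - m * x\<bar> \<le> x\<^sup>2 * (real m)\<^sup>2 * (1 + \<bar>x\<bar>) ^ m"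
proof (induction m)
  case (Suc m)
  have "(1 + x) ^ Suc m - 1 - Suc m * x = (1 + x) * ((1 + x) ^ m - 1 - m * x) + m * x\<^sup>2"
    by (simp add: algebra_simps power2_eq_square)
  then have "\<bar>(1 + x) ^ Suc m - 1 - Suc m * x\<bar> \<le> \<bar>1 + x\<bar> * \<bar>(1 + x) ^ m - 1 - m * x\<bar> + m * x\<^sup>2"
    by (metis (no_types, opaque_lifting) abs_triangle_ineq abs_mult abs_of_nonneg abs_power2 abs_of_nat)
  also have "\<dots> \<le> (1 + \<bar>x\<bar>) * (x\<^sup>2 * (real m)\<^sup>2 * (1 + \<bar>x\<bar>) ^ m) + m * x\<^sup>2 * (1 + \<bar>x\<bar>) ^ Suc m"
  proof (rule add_mono)
    show "\<bar>1 + x\<bar> * \<bar>(1 + x) ^ m - 1 - m * x\<bar> \<le> (1 + \<bar>x\<bar>) * (x\<^sup>2 * (real m)\<^sup>2 * (1 + \<bar>x\<bar>) ^ m)"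
      by (intro mult_mono Suc.IH) auto
    show "real m * x\<^sup>2 \<le> real m * x\<^sup>2 * (1 + \<bar>x\<bar>) ^ Suc m"
      using mult_left_mono[OF one_le_power[of "1 + \<bar>x\<bar>" "Suc m"], of "real m * x\<^sup>2"] by simp
  qed
  also have "\<dots> = x\<^sup>2 * ((real m)\<^sup>2 + m) * (1 + \<bar>x\<bar>) ^ Suc m"
    by (simp add: algebra_simps)
  also have "\<dots> \<le> x\<^sup>2 * (real (Suc m))\<^sup>2 * (1 + \<bar>x\<bar>) ^ Suc m"
    by (intro mult_right_mono mult_left_mono) (auto simp: power2_eq_square algebra_simps)
  finally show ?case .
qed simp

text \<open>The whole perturbation is at most \<open>s * J * q\<close>, so its square supplies
  \<open>s\<^sup>2\<close>. The exponent \<open>m + 2\<close> counts two powers of \<open>q\<close>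
  from that square and \<open>m\<close> from the power of \<open>1 + \<bar>x\<bar>\<close>.
  \<open>A\<close> contains the upper bound \<open>s0\<close> in place of \<open>s\<close> and is
  therefore the same for all stepsizes.\<close>

lemma power_growth_factor_le:
  fixes a s s0 K \<eta> :: real
  assumes a: "\<bar>a\<bar> \<le> K" and s: "0 \<le> s" "s \<le> s0"
    and A: "A = m * K + (K * (1 + s0))\<^sup>2 * (real m)\<^sup>2 * (1 + s0 * (K * (1 + s0))) ^ m"
  shows "(1 + a * s * \<eta> + K * s\<^sup>2 * (1 + \<eta>^4)) ^ m \<le> 1 + m * a * s * \<eta> + s\<^sup>2 * A * (1 + \<eta>^4) ^ (m + 2)"
proof -
  define q where "q = 1 + \<eta>^4"
  define J where "J = K * (1 + s0)"
  define x where "x = a * s * \<eta> + K * s\<^sup>2 * q"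
  have K: "0 \<le> K" using a by linarith
  then have J: "0 \<le> J" using s by (simp add: J_def)
  have q1: "1 \<le> q" by (simp add: q_def)
  have eta: "\<bar>\<eta>\<bar> \<le> q"
  proof (cases "\<bar>\<eta>\<bar> \<le> 1")
    case False
    then have "\<bar>\<eta>\<bar> ^ 1 \<le> \<bar>\<eta>\<bar> ^ 4" by (intro power_increasing) auto
    then show ?thesis by (simp add: q_def)
  qed (use q1 in linarith)
  have x: "\<bar>x\<bar> \<le> s * J * q"
  proof -
    have "\<bar>x\<bar> \<le> \<bar>a\<bar> * s * \<bar>\<eta>\<bar> + K * s\<^sup>2 * q"
      using s K q1 unfolding x_def by (intro order_trans[OF abs_triangle_ineq] add_mono) (auto simp: abs_mult)
    also have "\<dots> \<le> K * s * q + K * (s * s0) * q"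
      using s K q1 a eta by (intro add_mono mult_mono mult_nonneg_nonneg) (auto simp: power2_eq_square mult_left_mono)
    finally show ?thesis by (simp add: J_def algebra_simps)
  qed
  have x1: "1 + \<bar>x\<bar> \<le> (1 + s0 * J) * q"
  proof -
    have "s * J * q \<le> s0 * J * q" using s J q1 by (intro mult_right_mono) auto
    with x q1 show ?thesis by (simp add: algebra_simps)
  qed
  have "(1 + x) ^ m \<le> 1 + m * x + x\<^sup>2 * (real m)\<^sup>2 * (1 + \<bar>x\<bar>) ^ m"
    using power_first_order_bound[of x m] by linarith
  also have "x\<^sup>2 * (real m)\<^sup>2 * (1 + \<bar>x\<bar>) ^ m \<le> (s * J * q)\<^sup>2 * (real m)\<^sup>2 * ((1 + s0 * J) * q) ^ m"
    using x x1 q1 J s by (intro mult_mono mult_nonneg_nonneg zero_le_power power_mono[of "1 + \<bar>x\<bar>"])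
      (auto simp: abs_le_square_iff[symmetric])
  also have "\<dots> = s\<^sup>2 * (J\<^sup>2 * (real m)\<^sup>2 * (1 + s0 * J) ^ m) * q ^ (m + 2)"
    by (simp add: power_mult_distrib power_add power2_eq_square mult_ac)
  \<comment> \<open>Only the part of \<open>x\<close> with \<open>K\<close> joins the remainder; the
    part linear in \<open>\<eta>\<close> stays for the expectation to remove.\<close>
  also have "m * x \<le> m * a * s * \<eta> + s\<^sup>2 * (m * K) * q ^ (m + 2)"
  proof -
    have "s\<^sup>2 * (m * K) * q \<le> s\<^sup>2 * (m * K) * q ^ (m + 2)"
      using q1 K by (intro mult_left_mono self_le_power) auto
    then show ?thesis by (simp add: x_def algebra_simps)
  qed
  finally show ?thesis
    unfolding A J_def[symmetric] x_def q_def[symmetric] by (simp add: algebra_simps)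
qed

lemma integrable_std_normal_one_plus_power4:
  "integrable lborel (\<lambda>x. std_normal_density x * (1 + x^4) ^ j)"
proof -
  have "(1 + x^4) ^ j = (\<Sum>i\<le>j. real (j choose i) * x ^ (4 * i))" for x :: real
    using binomial_ring[of "x^4" 1 j] by (simp add: power_mult add.commute)
  then have "(\<lambda>x. std_normal_density x * (1 + x^4) ^ j) =
      (\<lambda>x. \<Sum>i\<le>j. real (j choose i) * (std_normal_density x * x ^ (4 * i)))"
    by (simp add: sum_distrib_left mult_ac)
  then show ?thesis
    by (simp add: integrable_std_normal_moment del: power_mult)
qed

text \<open>After standardising \<open>X\<close>, the linear term has mean zero, so the excess over
  1 is of order \<open>s\<^sup>2\<close>, the variance of the increment. This order, rather than
  \<open>s\<close>, keeps the product over all steps bounded.\<close>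

lemma (in prob_space) nn_integral_normal_growth_factor:
  fixes X :: "'a \<Rightarrow> real"
  assumes X: "distributed M lborel X (normal_density 0 s)"
    and a: "\<bar>a\<bar> \<le> K" and s: "0 < s" "s \<le> s0"
    and A: "A = m * K + (K * (1 + s0))\<^sup>2 * (real m)\<^sup>2 * (1 + s0 * (K * (1 + s0))) ^ m"
    and \<Phi>: "\<And>\<eta>. 0 \<le> \<Phi> (s * \<eta>)" "\<And>\<eta>. \<Phi> (s * \<eta>) \<le> 1 + a * s * \<eta> + K * s\<^sup>2 * (1 + \<eta>^4)"
  shows "(\<integral>\<^sup>+\<omega>. ennreal (\<Phi> (X \<omega>) ^ m) \<partial>M) \<le>
    ennreal (1 + s\<^sup>2 * (A * (\<integral>x. std_normal_density x * (1 + x^4) ^ (m + 2) \<partial>lborel)))"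
proof -
  define Y where "Y = (\<lambda>\<omega>. X \<omega> / s)"
  have Y: "distributed M lborel Y std_normal_density"
    using normal_standard_normal_convert[of s X 0] X s by (simp add: Y_def)
  have XY: "X \<omega> = s * Y \<omega>" for \<omega> using s by (simp add: Y_def)
  have K: "0 \<le> K" using a by linarith
  then have A0: "0 \<le> A" using s by (simp add: A)
  let ?B = "\<lambda>y. 1 + m * a * s * y + s\<^sup>2 * A * (1 + y^4) ^ (m + 2)"
  have le: "\<Phi> (s * y) ^ m \<le> ?B y" for y
    using power_mono[OF \<Phi>(2)[of y] \<Phi>(1), of m]
      power_growth_factor_le[OF a less_imp_le[OF s(1)] s(2) A, of y] by linarith
  have int1: "integrable M Y" 
    using integrable_std_normal_moment[of 1] by (intro distributed_integrable_var[OF Y]) auto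
  have int4: "integrable M (\<lambda>\<omega>. (1 + (Y \<omega>)^4) ^ (m + 2))"
    using integrable_std_normal_one_plus_power4[of "m + 2"] 
    by (subst distributed_integrable[OF Y, symmetric]) auto
  have e4: "expectation (\<lambda>\<omega>. (1 + (Y \<omega>)^4) ^ (m + 2)) = (\<integral>x. std_normal_density x * (1 + x^4) ^ (m + 2) \<partial>lborel)"
    by (subst distributed_integral[OF Y, symmetric]) auto
  have intB: "integrable M (\<lambda>\<omega>. ?B (Y \<omega>))"
    using int1 int4 by (intro Bochner_Integration.integrable_add integrable_mult_right) auto
  have "(\<integral>\<^sup>+\<omega>. ennreal (\<Phi> (X \<omega>) ^ m) \<partial>M) \<le> (\<integral>\<^sup>+\<omega>. ennreal (?B (Y \<omega>)) \<partial>M)"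
    unfolding XY by (intro nn_integral_mono ennreal_leI le)
  also have "\<dots> = ennreal (expectation (\<lambda>\<omega>. ?B (Y \<omega>)))"
  proof (rule nn_integral_eq_integral[OF intB])
    \<comment> \<open>The linear term of \<open>?B\<close> may be negative, but \<open>?B\<close> as
      a whole lies above a power of the nonnegative \<open>\<Phi>\<close>.\<close>
    show "AE \<omega> in M. 0 \<le> ?B (Y \<omega>)"
      using le zero_le_power[OF \<Phi>(1)] order_trans by (intro AE_I2) blast
  qed
  also have "expectation (\<lambda>\<omega>. ?B (Y \<omega>)) = 1 + m * a * s * expectation Y + s\<^sup>2 * A * expectation (\<lambda>\<omega>. (1 + (Y \<omega>)^4) ^ (m + 2))"
    using int1 int4 by (simp add: prob_space)
  also have "expectation Y = 0" by (rule standard_normal_distributed_expectation[OF Y])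
  finally show ?thesis by (simp only: e4 mult_zero_right add_0_right mult.assoc)
qed

section \<open>Independence of the past\<close>

text \<open>This takes the place of conditioning on \<open>F\<close>: \<open>Y\<close> is integrated
  out with the past frozen. On rectangles, independence makes the joint law of
  \<open>\<omega>\<close> and \<open>Y\<close> a product measure, and Tonelli then gives the
  iterated integral.\<close>

lemma (in prob_space) nn_integral_indep_subalgebra:
  assumes F: "subalgebra M F"
    and Y [measurable]: "Y \<in> borel_measurable M"
    and indep: "indep_set (sets F) (sets (vimage_algebra (space M) Y borel))"
    and \<phi>: "case_prod \<phi> \<in> borel_measurable (F \<Otimes>\<^sub>M borel)"
  shows "(\<integral>\<^sup>+\<omega>. \<phi> \<omega> (Y \<omega>) \<partial>M) = (\<integral>\<^sup>+\<omega>. (\<integral>\<^sup>+\<omega>'. \<phi> \<omega> (Y \<omega>') \<partial>M) \<partial>M)"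
proof -
  \<comment> \<open>\<open>F\<close> is coarser than \<open>M\<close>, so the identity is
    measurable, and pushing \<open>M\<close> forward along it restricts \<open>M\<close> to
    \<open>F\<close>.\<close>
  have id [measurable]: "(\<lambda>\<omega>. \<omega>) \<in> measurable M F"
    using F by (auto simp: subalgebra_def intro!: measurableI)
  have spF: "space F = space M" using F by (simp add: subalgebra_def)
  interpret D: prob_space "distr M borel Y" by (rule prob_space_distr) fact
  interpret P: prob_space "distr M F (\<lambda>\<omega>. \<omega>)" by (rule prob_space_distr) fact
  have eq: "distr M F (\<lambda>\<omega>. \<omega>) \<Otimes>\<^sub>M distr M borel Y = distr M (F \<Otimes>\<^sub>M borel) (\<lambda>\<omega>. (\<omega>, Y \<omega>))"
  proof (rule pair_measure_eqI)
    fix A B assume "A \<in> sets (distr M F (\<lambda>\<omega>. \<omega>))" and "B \<in> sets (distr M borel Y)"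
    then have A: "A \<in> sets F" and B: "B \<in> sets borel" by simp_all
    have "A \<inter> space M = A"
      using sets.sets_into_space[OF A] by (simp add: spF Int_absorb2)
    moreover have "(\<lambda>\<omega>. (\<omega>, Y \<omega>)) -` (A \<times> B) \<inter> space M = A \<inter> (Y -` B \<inter> space M)"
      using \<open>A \<inter> space M = A\<close> by auto
    moreover have "prob (A \<inter> (Y -` B \<inter> space M)) = prob A * prob (Y -` B \<inter> space M)"
      using A B by (intro indep_setD[OF indep] in_vimage_algebra)
    ultimately show "emeasure (distr M F (\<lambda>\<omega>. \<omega>)) A * emeasure (distr M borel Y) B =
        emeasure (distr M (F \<Otimes>\<^sub>M borel) (\<lambda>\<omega>. (\<omega>, Y \<omega>))) (A \<times> B)"
      using A B by (simp add: emeasure_distr emeasure_eq_measure ennreal_mult)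
  qed (auto intro: P.sigma_finite_measure_axioms D.sigma_finite_measure_axioms simp: cong: sets_pair_measure_cong)
  note \<phi>[measurable]
  have "(\<integral>\<^sup>+\<omega>. \<phi> \<omega> (Y \<omega>) \<partial>M) = (\<integral>\<^sup>+p. case_prod \<phi> p \<partial>distr M (F \<Otimes>\<^sub>M borel) (\<lambda>\<omega>. (\<omega>, Y \<omega>)))"
    by (subst nn_integral_distr) auto
  also have "\<dots> = (\<integral>\<^sup>+\<omega>. (\<integral>\<^sup>+y. \<phi> \<omega> y \<partial>distr M borel Y) \<partial>distr M F (\<lambda>\<omega>. \<omega>))"
    by (subst eq[symmetric], subst D.nn_integral_fst[symmetric]) (auto cong: measurable_cong_sets)
  also have "\<dots> = (\<integral>\<^sup>+\<omega>. (\<integral>\<^sup>+y. \<phi> \<omega> y \<partial>distr M borel Y) \<partial>M)"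
    by (subst nn_integral_distr) (auto cong: measurable_cong_sets)
  also have "\<dots> = (\<integral>\<^sup>+\<omega>. (\<integral>\<^sup>+\<omega>'. \<phi> \<omega> (Y \<omega>') \<partial>M) \<partial>M)"
  proof (rule nn_integral_cong)
    fix \<omega> assume "\<omega> \<in> space M"
    then have "\<omega> \<in> space F" by (simp add: spF)
    then have [measurable]: "\<phi> \<omega> \<in> borel_measurable borel"
      using measurable_Pair2[OF \<phi>, of \<omega>] by simp
    show "(\<integral>\<^sup>+y. \<phi> \<omega> y \<partial>distr M borel Y) = (\<integral>\<^sup>+\<omega>'. \<phi> \<omega> (Y \<omega>') \<partial>M)"
      by (subst nn_integral_distr) auto
  qed
  finally show ?thesis .
qed

section \<open>A maximal inequality\<close>

primrec running_max :: "(nat \<Rightarrow> 'a \<Rightarrow> real) \<Rightarrow> nat \<Rightarrow> 'a \<Rightarrow> real" where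
  "running_max U 0 \<omega> = U 0 \<omega>"
| "running_max U (Suc n) \<omega> = max (running_max U n \<omega>) (U (Suc n) \<omega>)"

lemma running_max_ge: "j \<le> n \<Longrightarrow> U j \<omega> \<le> running_max U n \<omega>"
  by (induction n) (auto simp: le_Suc_eq intro: le_max_iff_disj[THEN iffD2])

lemma borel_measurable_running_max:
  assumes "\<And>k. k \<le> n \<Longrightarrow> U k \<in> borel_measurable M"
  shows "running_max U n \<in> borel_measurable M"
  using assms
proof (induction n)
  case 0 then show ?case by (simp add: running_max.simps(1)[abs_def] cong: measurable_cong)
next
  case (Suc n)
  then have "(\<lambda>\<omega>. max (running_max U n \<omega>) (U (Suc n) \<omega>)) \<in> borel_measurable M"
    by (intro borel_measurable_max) auto
  then show ?case by (simp cong: measurable_cong)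
qed

text \<open>For \<open>u\<close> above \<open>m\<close>, with \<open>t = sqrt u\<close> and
  \<open>r = sqrt m\<close>, the claim is \<open>2 * t \<le> r + t\<^sup>2 / r\<close>, that is
  \<open>0 \<le> (t - r)\<^sup>2\<close>; otherwise the maximum is unchanged. It allows a new
  running maximum to be replaced by the previous one.\<close>

lemma sqrt_max_supermartingale_step:
  fixes m u :: real
  assumes "0 < m"  "0 \<le> u"
  shows "sqrt (max m u) + u / sqrt (max m u) \<le> sqrt m + u / sqrt m"
proof (cases "u \<le> m")
  case False
  define r where "r = sqrt m"
  define t where "t = sqrt u"
  have r: "0 < r" "0 < t" "u = t * t" using False assms by (auto simp: r_def t_def)
  have "2 * t * r \<le> r * r + t * t"
    using zero_le_square[of "t - r"] by (simp add: algebra_simps)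
  then have "t + t \<le> r + t * t / r"
    using r by (simp add: field_simps)
  then show ?thesis using False r by (simp add: max_def r_def[symmetric] t_def[symmetric])
qed (simp add: max_def)

text \<open>A substitute for Doob's inequality: \<open>sqrt S + U / sqrt S\<close>, with \<open>S\<close> the running maximum of
  \<open>U\<close>, inherits the growth of \<open>U\<close>, and it dominates \<open>sqrt S\<close>. The factor
  \<open>1 / sqrt S\<close> is the past-measurable weight \<open>h\<close> of the assumption.\<close>

lemma nn_integral_sqrt_running_max_le:
  fixes U :: "nat \<Rightarrow> 'a \<Rightarrow> real"
  assumes sub: "\<And>k. k \<le> n \<Longrightarrow> subalgebra M (G k)"
    and mono: "\<And>j k. j \<le> k \<Longrightarrow> k \<le> n \<Longrightarrow> sets (G j) \<subseteq> sets (G k)"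
    and U: "\<And>k. k \<le> n \<Longrightarrow> U k \<in> borel_measurable (G k)"
    and pos: "\<And>k \<omega>. k \<le> n \<Longrightarrow> 0 < U k \<omega>"
    and r: "1 \<le> r"
    and step: "\<And>k h. k < n \<Longrightarrow> h \<in> borel_measurable (G k) \<Longrightarrow> (\<And>\<omega>. 0 \<le> h \<omega>) \<Longrightarrow>
      (\<integral>\<^sup>+\<omega>. ennreal (h \<omega> * U (Suc k) \<omega>) \<partial>M) \<le> ennreal r * (\<integral>\<^sup>+\<omega>. ennreal (h \<omega> * U k \<omega>) \<partial>M)"
  shows "(\<integral>\<^sup>+\<omega>. ennreal (sqrt (running_max U n \<omega>)) \<partial>M) \<le> ennreal (r ^ n) * (\<integral>\<^sup>+\<omega>. ennreal (2 * sqrt (U 0 \<omega>)) \<partial>M)"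
proof -
  let ?S = "running_max U"
  let ?\<phi> = "\<lambda>k \<omega>. sqrt (?S k \<omega>) + U k \<omega> / sqrt (?S k \<omega>)"
  have S_pos: "0 < ?S k \<omega>" if "k \<le> n" for k \<omega>
    using pos[OF that, of \<omega>] running_max_ge[of k k U \<omega>] by simp
  have S_meas: "?S k \<in> borel_measurable (G k)" if k: "k \<le> n" for k
  proof (rule borel_measurable_running_max)
    fix j assume j: "j \<le> k"
    then have "subalgebra (G k) (G j)"
      using sub[OF k] sub[of j] mono[OF j k] k by (auto simp: subalgebra_def)
    then show "U j \<in> borel_measurable (G k)"
      using U[of j] j k by (intro measurable_from_subalg[of "G k" "G j"]) auto
  qed
  have "(\<integral>\<^sup>+\<omega>. ennreal (?\<phi> k \<omega>) \<partial>M) \<le> ennreal (r ^ k) * (\<integral>\<^sup>+\<omega>. ennreal (2 * sqrt (U 0 \<omega>)) \<partial>M)" if "k \<le> n" for k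
    using that
  proof (induction k)
    case 0
    \<comment> \<open>At time 0 the running maximum is \<open>U 0\<close>, so both summands equal
      \<open>sqrt (U 0 \<omega>)\<close>; hence the factor 2.\<close>
    have "?\<phi> 0 \<omega> = 2 * sqrt (U 0 \<omega>)" for \<omega>
      using pos[of 0 \<omega>] by (simp add: real_div_sqrt)
    then show ?case by simp
  next
    case (Suc k)
    then have k: "k < n" "k \<le> n" by auto
    have M_S: "?S k \<in> borel_measurable M" and M_U: "U k \<in> borel_measurable M" 
      using S_meas[OF k(2)] U[OF k(2)] sub[OF k(2)] measurable_from_subalg by blast+
    have M_U': "U (Suc k) \<in> borel_measurable M"
      using U[OF Suc.prems] sub[OF Suc.prems] measurable_from_subalg by blast
    note [measurable] = M_S M_U M_U'
    let ?h = "\<lambda>\<omega>. 1 / sqrt (?S k \<omega>)"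
    have h: "?h \<in> borel_measurable (G k)" "\<And>\<omega>. 0 \<le> ?h \<omega>"
      using S_meas[OF k(2)] S_pos[OF k(2)] by (auto intro!: less_imp_le)
    \<comment> \<open>The new running maximum is first replaced pointwise by the previous one, whose
      inverse root depends on the past alone; only then does \<open>step\<close> apply.\<close>
    have "(\<integral>\<^sup>+\<omega>. ennreal (?\<phi> (Suc k) \<omega>) \<partial>M) \<le> (\<integral>\<^sup>+\<omega>. ennreal (sqrt (?S k \<omega>)) + ennreal (?h \<omega> * U (Suc k) \<omega>) \<partial>M)"
    proof (rule nn_integral_mono)
      fix \<omega>
      have "?\<phi> (Suc k) \<omega> \<le> sqrt (?S k \<omega>) + U (Suc k) \<omega> / sqrt (?S k \<omega>)"
        using sqrt_max_supermartingale_step[OF S_pos[OF k(2)], of "U (Suc k) \<omega>" \<omega>] pos[OF Suc.prems, of \<omega>] by simp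
      also have "ennreal \<dots> = ennreal (sqrt (?S k \<omega>)) + ennreal (?h \<omega> * U (Suc k) \<omega>)"
        using S_pos[OF k(2), of \<omega>] pos[OF Suc.prems, of \<omega>] by (subst ennreal_plus[symmetric]) auto
      finally show "ennreal (?\<phi> (Suc k) \<omega>) \<le> ennreal (sqrt (?S k \<omega>)) + ennreal (?h \<omega> * U (Suc k) \<omega>)"
        by (simp add: ennreal_leI)
    qed
    also have "\<dots> = (\<integral>\<^sup>+\<omega>. ennreal (sqrt (?S k \<omega>)) \<partial>M) + (\<integral>\<^sup>+\<omega>. ennreal (?h \<omega> * U (Suc k) \<omega>) \<partial>M)"
      by (intro nn_integral_add) auto
    \<comment> \<open>The first summand does not grow; it is multiplied by \<open>r \<ge> 1\<close>
      to share a common factor with the second.\<close>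
    also have "\<dots> \<le> ennreal r * (\<integral>\<^sup>+\<omega>. ennreal (sqrt (?S k \<omega>)) \<partial>M) + ennreal r * (\<integral>\<^sup>+\<omega>. ennreal (?h \<omega> * U k \<omega>) \<partial>M)"
    proof (intro add_mono step k h)
      show "(\<integral>\<^sup>+\<omega>. ennreal (sqrt (?S k \<omega>)) \<partial>M) \<le> ennreal r * (\<integral>\<^sup>+\<omega>. ennreal (sqrt (?S k \<omega>)) \<partial>M)"
        using r mult_right_mono[of 1 "ennreal r"] by fastforce
    qed
    also have "\<dots> = ennreal r * (\<integral>\<^sup>+\<omega>. ennreal (sqrt (?S k \<omega>)) + ennreal (?h \<omega> * U k \<omega>) \<partial>M)"
      by (subst nn_integral_add) (auto simp: distrib_left)
    also have "(\<integral>\<^sup>+\<omega>. ennreal (sqrt (?S k \<omega>)) + ennreal (?h \<omega> * U k \<omega>) \<partial>M) = (\<integral>\<^sup>+\<omega>. ennreal (?\<phi> k \<omega>) \<partial>M)"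
      using S_pos[OF k(2)] pos[OF k(2)]
      by (intro nn_integral_cong, subst ennreal_plus[symmetric]) (auto intro: less_imp_le divide_nonneg_nonneg)
    also have "ennreal r * \<dots> \<le> ennreal r * (ennreal (r ^ k) * (\<integral>\<^sup>+\<omega>. ennreal (2 * sqrt (U 0 \<omega>)) \<partial>M))"
      using Suc k by (intro mult_left_mono) auto
    also have "\<dots> = ennreal (r ^ Suc k) * (\<integral>\<^sup>+\<omega>. ennreal (2 * sqrt (U 0 \<omega>)) \<partial>M)"
      using r by (simp add: ennreal_mult mult.assoc)
    finally show ?case .
  qed
  note this[OF order_refl]
  moreover have "(\<integral>\<^sup>+\<omega>. ennreal (sqrt (?S n \<omega>)) \<partial>M) \<le> (\<integral>\<^sup>+\<omega>. ennreal (?\<phi> n \<omega>) \<partial>M)"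
    using S_pos[OF order_refl] pos[OF order_refl]
    by (intro nn_integral_mono ennreal_leI) (auto intro: less_imp_le divide_nonneg_nonneg)
  ultimately show ?thesis by (rule order_trans[rotated])
qed

section \<open>Markov chains driven by Brownian increments\<close>

text \<open>Testing against all nonnegative past-measurable weights \<open>h\<close> expresses a
  conditional inequality. Independence freezes \<open>Z\<close>; the normal estimate then applies to
  the ratio of the new to the old value of \<open>1 + (norm z)\<^sup>2\<close>, with the same bound
  for every frozen value.\<close>

lemma (in brownian_motion) nn_integral_markov_step_le:
  fixes \<Psi> :: "'b::euclidean_space \<Rightarrow> real \<Rightarrow> 'b"
  assumes t: "0 \<le> t" and d: "0 < d" "d \<le> T"
    and Z: "Z \<in> borel_measurable (F t)"
    and \<Psi>: "case_prod \<Psi> \<in> borel_measurable (borel \<Otimes>\<^sub>M borel)"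
    and growth: "\<And>z. \<exists>a. \<bar>a\<bar> \<le> K \<and> (\<forall>\<eta>. 1 + (norm (\<Psi> z (sqrt d * \<eta>)))\<^sup>2
      \<le> (1 + (norm z)\<^sup>2) * (1 + a * sqrt d * \<eta> + K * (sqrt d)\<^sup>2 * (1 + \<eta>^4)))"
    and A: "A = m * K + (K * (1 + sqrt T))\<^sup>2 * (real m)\<^sup>2 * (1 + sqrt T * (K * (1 + sqrt T))) ^ m"
    and h: "h \<in> borel_measurable (F t)" "\<And>\<omega>. 0 \<le> h \<omega>"
  shows "(\<integral>\<^sup>+\<omega>. ennreal (h \<omega> * (1 + (norm (\<Psi> (Z \<omega>) (w (t + d) \<omega> - w t \<omega>)))\<^sup>2) ^ m) \<partial>M) \<le>
    ennreal (1 + d * (A * (\<integral>x. std_normal_density x * (1 + x^4) ^ (m + 2) \<partial>lborel))) *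
    (\<integral>\<^sup>+\<omega>. ennreal (h \<omega> * (1 + (norm (Z \<omega>))\<^sup>2) ^ m) \<partial>M)"
proof -
  define W where "W = (\<lambda>\<omega>. w (t + d) \<omega> - w t \<omega>)"
  define \<kappa> where "\<kappa> = 1 + d * (A * (\<integral>x. std_normal_density x * (1 + x^4) ^ (m + 2) \<partial>lborel))"
  have W: "distributed M lborel W (normal_density 0 (sqrt d))"
    using increment_normal[of t "t + d"] t d by (simp add: W_def)
  have [measurable]: "W \<in> borel_measurable M"
    using distributed_measurable[OF W] by simp
  have subt: "subalgebra M (F t)" using sub t by simp
  note [measurable] = Z h(1) \<Psi>
  have [measurable]: "Z \<in> borel_measurable M" "h \<in> borel_measurable M"
    using measurable_from_subalg[OF subt] Z h(1) by blast+
  let ?V = "\<lambda>z. 1 + (norm z)\<^sup>2"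
  let ?\<phi> = "\<lambda>\<omega> x. ennreal (h \<omega> * ?V (\<Psi> (Z \<omega>) x) ^ m)"
  have [measurable]: "(\<lambda>p. \<Psi> (Z (fst p)) (snd p)) \<in> borel_measurable (F t \<Otimes>\<^sub>M borel)"
    using measurable_compose[OF measurable_Pair[of "\<lambda>p. Z (fst p)" "F t \<Otimes>\<^sub>M borel" borel snd borel] \<Psi>] by simp
  have "(\<integral>\<^sup>+\<omega>. ?\<phi> \<omega> (W \<omega>) \<partial>M) = (\<integral>\<^sup>+\<omega>. (\<integral>\<^sup>+\<omega>'. ?\<phi> \<omega> (W \<omega>') \<partial>M) \<partial>M)"
  proof (rule nn_integral_indep_subalgebra[OF subt])
    show "indep_set (sets (F t)) (sets (vimage_algebra (space M) W borel))"
      using increment_indep[of t "t + d"] t d by (simp add: W_def)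
  qed (auto simp: case_prod_beta)
  also have "\<dots> \<le> (\<integral>\<^sup>+\<omega>. ennreal \<kappa> * ennreal (h \<omega> * ?V (Z \<omega>) ^ m) \<partial>M)"
  proof (rule nn_integral_mono)
    fix \<omega>
    let ?z = "Z \<omega>"
    obtain a where a: "\<bar>a\<bar> \<le> K" and le: "\<And>\<eta>. ?V (\<Psi> ?z (sqrt d * \<eta>))
        \<le> ?V ?z * (1 + a * sqrt d * \<eta> + K * (sqrt d)\<^sup>2 * (1 + \<eta>^4))"
      using growth[of ?z] by auto
    have Vz: "0 < ?V ?z" by (simp add: add_pos_nonneg)
    have [measurable]: "(\<lambda>\<omega>'. \<Psi> ?z (W \<omega>')) \<in> borel_measurable M"
      using measurable_compose[OF measurable_Pair[of "\<lambda>_. ?z" M borel W borel] \<Psi>] by simp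
    have inner: "(\<integral>\<^sup>+\<omega>'. ennreal ((?V (\<Psi> ?z (W \<omega>')) / ?V ?z) ^ m) \<partial>M) \<le>
      ennreal (1 + (sqrt d)\<^sup>2 * (A * (\<integral>x. std_normal_density x * (1 + x^4) ^ (m + 2) \<partial>lborel)))"
    proof (rule nn_integral_normal_growth_factor[OF W a _ _ A])
      fix \<eta> show "?V (\<Psi> ?z (sqrt d * \<eta>)) / ?V ?z \<le> 1 + a * sqrt d * \<eta> + K * (sqrt d)\<^sup>2 * (1 + \<eta>^4)"
        using le[of \<eta>] Vz by (simp add: pos_divide_le_eq mult.commute)
    qed (use d in auto)
    have "(\<integral>\<^sup>+\<omega>'. ?\<phi> \<omega> (W \<omega>') \<partial>M) =
        (\<integral>\<^sup>+\<omega>'. ennreal (h \<omega> * ?V ?z ^ m) * ennreal ((?V (\<Psi> ?z (W \<omega>')) / ?V ?z) ^ m) \<partial>M)"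
      using h(2)[of \<omega>] Vz
      by (intro nn_integral_cong, subst ennreal_mult[symmetric]) (auto simp: power_divide field_simps)
    also have "\<dots> = ennreal (h \<omega> * ?V ?z ^ m) * (\<integral>\<^sup>+\<omega>'. ennreal ((?V (\<Psi> ?z (W \<omega>')) / ?V ?z) ^ m) \<partial>M)"
      by (intro nn_integral_cmult) measurable
    also have "\<dots> \<le> ennreal (h \<omega> * ?V ?z ^ m) * ennreal \<kappa>"
      using inner d by (intro mult_left_mono) (simp_all add: \<kappa>_def)
    finally show "(\<integral>\<^sup>+\<omega>'. ?\<phi> \<omega> (W \<omega>') \<partial>M) \<le> ennreal \<kappa> * ennreal (h \<omega> * ?V ?z ^ m)"
      by (simp only: mult.commute)
  qed
  also have "\<dots> = ennreal \<kappa> * (\<integral>\<^sup>+\<omega>. ennreal (h \<omega> * ?V (Z \<omega>) ^ m) \<partial>M)"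
    by (intro nn_integral_cmult) measurable
  finally show ?thesis by (simp add: W_def \<kappa>_def)
qed

text \<open>The power is \<open>2 * q\<close>, twice the wanted one, because the maximal inequality
  controls the square root of the maximum.\<close>

lemma (in brownian_motion) markov_chain_running_max_le:
  fixes \<Psi> :: "'b::euclidean_space \<Rightarrow> real \<Rightarrow> 'b"
  assumes d: "0 < d" "real N * d = T" and N: "0 < N"
    and \<Psi>: "case_prod \<Psi> \<in> borel_measurable (borel \<Otimes>\<^sub>M borel)"
    and Z0: "\<And>\<omega>. Z 0 \<omega> = z0"
    and Z_Suc: "\<And>k \<omega>. Z (Suc k) \<omega> = \<Psi> (Z k \<omega>) (w (real (k + 1) * d) \<omega> - w (real k * d) \<omega>)"
    and growth: "\<And>z. \<exists>a. \<bar>a\<bar> \<le> K \<and> (\<forall>\<eta>. 1 + (norm (\<Psi> z (sqrt d * \<eta>)))\<^sup>2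
      \<le> (1 + (norm z)\<^sup>2) * (1 + a * sqrt d * \<eta> + K * (sqrt d)\<^sup>2 * (1 + \<eta>^4)))"
    and A: "A = real (2 * q) * K + (K * (1 + sqrt T))\<^sup>2 * (real (2 * q))\<^sup>2 * (1 + sqrt T * (K * (1 + sqrt T))) ^ (2 * q)"
  shows "Z k \<in> borel_measurable M"
    and "(\<integral>\<^sup>+\<omega>. ennreal (sqrt (running_max (\<lambda>k \<omega>. (1 + (norm (Z k \<omega>))\<^sup>2) ^ (2 * q)) N \<omega>)) \<partial>M) \<le>
      ennreal (exp (T * (A * (\<integral>x. std_normal_density x * (1 + x^4) ^ (2 * q + 2) \<partial>lborel))) *
        (2 * (1 + (norm z0)\<^sup>2) ^ q))"
proof -
  define C where "C = A * (\<integral>x. std_normal_density x * (1 + x^4) ^ (2 * q + 2) \<partial>lborel)"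
  have K: "0 \<le> K" using growth[of 0] by (auto intro: order_trans[OF abs_ge_zero])
  have T: "0 \<le> T" using d by auto
  have C: "0 \<le> C"
  proof -
    have "0 \<le> (\<integral>x. std_normal_density x * (1 + x^4) ^ (2 * q + 2) \<partial>lborel)"
      by (intro Bochner_Integration.integral_nonneg) simp
    moreover have "0 \<le> A" using K T by (simp add: A)
    ultimately show ?thesis by (simp add: C_def)
  qed
  have dT: "d \<le> T"
    using d N mult_right_mono[of 1 "real N" d] by simp
  have sub': "subalgebra M (F (real k * d))" for k
    using d by (intro sub) auto
  have mono': "sets (F (real j * d)) \<subseteq> sets (F (real k * d))" if "j \<le> k" for j k
    using d that by (intro mono mult_right_mono) auto
  have subk: "subalgebra (F (real k * d)) (F (real j * d))" if "j \<le> k" for j k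
    using sub'[of j] sub'[of k] mono'[OF that] by (auto simp: subalgebra_def)
  have Zk: "Z k \<in> borel_measurable (F (real k * d))" for k
  proof (induction k)
    case 0
    then show ?case by (simp add: Z0 cong: measurable_cong)
  next
    case (Suc k)
    have "w (real j * d) \<in> borel_measurable (F (real (Suc k) * d))" if "j \<le> Suc k" for j
      using d by (intro measurable_from_subalg[OF subk[OF that]] adapted) auto
    from this[of k] this[of "Suc k"]
    have W: "(\<lambda>\<omega>. w (real (k + 1) * d) \<omega> - w (real k * d) \<omega>) \<in> borel_measurable (F (real (Suc k) * d))"
      by (intro borel_measurable_diff) auto
    have "Z k \<in> borel_measurable (F (real (Suc k) * d))"
      by (rule measurable_from_subalg[OF subk Suc.IH]) auto
    from measurable_compose[OF measurable_Pair[OF this W] \<Psi>] show ?case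
      unfolding Z_Suc[abs_def] by simp
  qed
  show "Z k \<in> borel_measurable M"
    by (rule measurable_from_subalg[OF sub' Zk])
  have "(\<integral>\<^sup>+\<omega>. ennreal (sqrt (running_max (\<lambda>k \<omega>. (1 + (norm (Z k \<omega>))\<^sup>2) ^ (2 * q)) N \<omega>)) \<partial>M) \<le>
      ennreal ((1 + d * C) ^ N) * (\<integral>\<^sup>+\<omega>. ennreal (2 * sqrt ((1 + (norm (Z 0 \<omega>))\<^sup>2) ^ (2 * q))) \<partial>M)"
  proof (rule nn_integral_sqrt_running_max_le[where G = "\<lambda>k. F (real k * d)"])
    fix k and h :: "'a \<Rightarrow> real"
    assume h: "h \<in> borel_measurable (F (real k * d))" "\<And>\<omega>. 0 \<le> h \<omega>"
    have "real (Suc k) * d = real k * d + d" by (simp add: algebra_simps)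
    then show "(\<integral>\<^sup>+\<omega>. ennreal (h \<omega> * (1 + (norm (Z (Suc k) \<omega>))\<^sup>2) ^ (2 * q)) \<partial>M)
        \<le> ennreal (1 + d * C) * (\<integral>\<^sup>+\<omega>. ennreal (h \<omega> * (1 + (norm (Z k \<omega>))\<^sup>2) ^ (2 * q)) \<partial>M)"
      using nn_integral_markov_step_le[OF _ d(1) dT Zk \<Psi> growth A h] d unfolding Z_Suc C_def by simp
  next
    fix k show "(\<lambda>\<omega>. (1 + (norm (Z k \<omega>))\<^sup>2) ^ (2 * q)) \<in> borel_measurable (F (real k * d))"
      using Zk[of k] by measurable
  qed (use C d in \<open>auto intro: sub' mono'[THEN subsetD] zero_less_power simp: add_pos_nonneg\<close>)
  also have "sqrt ((1 + (norm (Z 0 \<omega>))\<^sup>2) ^ (2 * q)) = (1 + (norm z0)\<^sup>2) ^ q" for \<omega>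
    by (simp only: Z0 power_even_eq real_sqrt_abs) simp
  then have "(\<integral>\<^sup>+\<omega>. ennreal (2 * sqrt ((1 + (norm (Z 0 \<omega>))\<^sup>2) ^ (2 * q))) \<partial>M) = ennreal (2 * (1 + (norm z0)\<^sup>2) ^ q)"
    by (simp add: emeasure_space_1)
  also have "ennreal ((1 + d * C) ^ N) * \<dots> \<le> ennreal (exp (T * C)) * ennreal (2 * (1 + (norm z0)\<^sup>2) ^ q)"
  proof (intro mult_right_mono ennreal_leI)
    \<comment> \<open>As \<open>N * d = T\<close>, the \<open>N\<close> growth factors compound to
      at most \<open>exp (T * C)\<close>, whatever the stepsize.\<close>
    have "(1 + d * C) ^ N \<le> exp (d * C) ^ N"
      using C d by (intro power_mono exp_ge_add_one_self) auto
    also have "\<dots> = exp (T * C)"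
      by (simp add: exp_of_nat_mult[symmetric] d(2)[symmetric] mult_ac)
    finally show "(1 + d * C) ^ N \<le> exp (T * C)" .
  qed auto
  finally show "(\<integral>\<^sup>+\<omega>. ennreal (sqrt (running_max (\<lambda>k \<omega>. (1 + (norm (Z k \<omega>))\<^sup>2) ^ (2 * q)) N \<omega>)) \<partial>M) \<le>
      ennreal (exp (T * (A * (\<integral>x. std_normal_density x * (1 + x^4) ^ (2 * q + 2) \<partial>lborel))) *
        (2 * (1 + (norm z0)\<^sup>2) ^ q))"
    by (simp add: ennreal_mult C_def)
qed

section \<open>Suprema, linear growth and the implicit equation\<close>

text \<open>Over a finite nonempty set the supremum is a maximum, dominated by \<open>R\<close>.
  Integrability is part of the conclusion because the integral of a non-integrable function is 0 by
  default, so the bound alone would say little.\<close>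

lemma integrable_SUP_bounded:
  fixes X :: "'i \<Rightarrow> 'a \<Rightarrow> real"
  assumes I: "finite I" "I \<noteq> {}"
    and X: "\<And>i. i \<in> I \<Longrightarrow> X i \<in> borel_measurable M"
    and le: "\<And>i \<omega>. i \<in> I \<Longrightarrow> 0 \<le> X i \<omega>" "\<And>i \<omega>. i \<in> I \<Longrightarrow> X i \<omega> \<le> R \<omega>"
    and R: "(\<integral>\<^sup>+\<omega>. ennreal (R \<omega>) \<partial>M) \<le> ennreal C" and C: "0 \<le> C"
  shows "integrable M (\<lambda>\<omega>. SUP i\<in>I. X i \<omega>) \<and> (\<integral>\<omega>. (SUP i\<in>I. X i \<omega>) \<partial>M) \<le> C"
proof -
  have meas: "(\<lambda>\<omega>. SUP i\<in>I. X i \<omega>) \<in> borel_measurable M"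
    using I X by (intro borel_measurable_cSUP) (auto intro: countable_finite)
  have SUP_le: "(SUP i\<in>I. X i \<omega>) \<le> R \<omega>" for \<omega>
    using I le by (intro cSUP_least) auto
  have SUP_nonneg: "0 \<le> (SUP i\<in>I. X i \<omega>)" for \<omega>
  proof -
    obtain i where i: "i \<in> I" using I by auto
    then have "X i \<omega> \<le> (SUP i\<in>I. X i \<omega>)" using I by (intro cSUP_upper) auto
    with le(1)[OF i, of \<omega>] show ?thesis by simp
  qed
  have *: "(\<integral>\<^sup>+\<omega>. ennreal (SUP i\<in>I. X i \<omega>) \<partial>M) \<le> ennreal C"
    using R by (rule order_trans[rotated]) (intro nn_integral_mono ennreal_leI SUP_le)
  then have "integrable M (\<lambda>\<omega>. SUP i\<in>I. X i \<omega>)"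
    using meas SUP_nonneg by (intro integrableI_nonneg) (auto intro: order.strict_trans1)
  moreover have "(\<integral>\<omega>. (SUP i\<in>I. X i \<omega>) \<partial>M) \<le> C"
    using C * by (rule integral_real_bounded)
  ultimately show ?thesis by blast
qed

text \<open>The absolute value covers a constant of unknown sign, such as \<open>\<sigma>\<close> in
  the theorem.\<close>

lemma sq_Lipschitz_norm_le:
  assumes "(norm a)\<^sup>2 \<le> c * (norm b)\<^sup>2"
  shows "norm a \<le> sqrt \<bar>c\<bar> * norm b"
proof (rule power2_le_imp_le)
  show "(norm a)\<^sup>2 \<le> (sqrt \<bar>c\<bar> * norm b)\<^sup>2"
    using assms mult_right_mono[OF abs_ge_self[of c], of "(norm b)\<^sup>2"] by (simp add: power_mult_distrib)
qed simp

lemma sq_Lipschitz_continuous: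
  assumes "\<And>x y. (norm (g x - g y))\<^sup>2 \<le> c * (norm (x - y))\<^sup>2"
  shows "continuous_on UNIV g"
  using sq_Lipschitz_norm_le[OF assms]
  by (intro lipschitz_on_continuous_on[of "sqrt \<bar>c\<bar>"] lipschitz_onI) (auto simp: dist_norm)

text \<open>In the application \<open>v\<close> is \<open>sqrt (1 + (norm z)\<^sup>2)\<close>; being
  at least 1, it absorbs the constant \<open>norm (g 0)\<close>.\<close>

lemma sq_Lipschitz_growth:
  assumes lip: "\<And>x y. (norm (g x - g y))\<^sup>2 \<le> c * (norm (x - y))\<^sup>2"
    and y: "norm y \<le> B * v" and v: "1 \<le> v"
  shows "norm (g y) \<le> (norm (g 0) + sqrt \<bar>c\<bar> * B) * v"
proof -
  have "norm (g y) \<le> norm (g 0) + norm (g y - g 0)"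
    using norm_triangle_sub[of "g y" "g 0"] by simp
  also have "norm (g y - g 0) \<le> sqrt \<bar>c\<bar> * norm y"
    using sq_Lipschitz_norm_le[OF lip[of y 0]] by simp
  also have "\<dots> \<le> sqrt \<bar>c\<bar> * (B * v)"
    by (intro mult_left_mono y) simp
  also have "norm (g 0) \<le> norm (g 0) * v"
    using v mult_left_mono[of 1 v "norm (g 0)"] by simp
  finally show ?thesis by (simp add: algebra_simps)
qed


text \<open>The resolvent map is injective by expansion and surjective, so the description operator
  meets exactly one solution.\<close>

lemma stm_resolvent:
  assumes mono: "\<And>x y. (x - y) \<bullet> (f x - f y) \<le> \<mu> * (norm (x - y))\<^sup>2"
    and h: "0 \<le> \<theta> * d" "\<theta> * d * \<mu> \<le> 1/2"
    and cont: "continuous_on UNIV f"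
  shows "stm f g \<theta> w x0 d k \<omega> = inv (\<lambda>x. x - (\<theta> * d) *\<^sub>R f x) (sstm f g \<theta> w x0 d k \<omega>)"
proof -
  let ?G = "\<lambda>x. x - (\<theta> * d) *\<^sub>R f x"
  have exp: "norm (x - y) \<le> 2 * norm (?G x - ?G y)" for x y
    using mono h by (rule one_sided_Lipschitz_resolvent_expanding)
  have inj: "inj ?G"
  proof (rule injI)
    fix x y assume "?G x = ?G y"
    then show "x = y" using exp[of x y] by simp
  qed
  have surj: "surj ?G"
    using mono h cont by (rule one_sided_Lipschitz_resolvent_surj)
  show ?thesis
  proof (cases k)
    case 0
    \<comment> \<open>\<open>sstm\<close> starts at the image of \<open>x0\<close>, so the inverse
      returns the prescribed value \<open>x0\<close>.\<close>
    then show ?thesis using inv_f_f[OF inj, of x0] by simp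
  next
    case (Suc j)
    have "(THE y. y = z + (\<theta> * d) *\<^sub>R f y) = inv ?G z" for z
    proof (rule the_equality)
      show "inv ?G z = z + (\<theta> * d) *\<^sub>R f (inv ?G z)"
        using surj_f_inv_f[OF surj, of z] by (simp add: algebra_simps)
      show "y = inv ?G z" if "y = z + (\<theta> * d) *\<^sub>R f y" for y
      proof -
        have "?G y = z" by (subst that) simp
        then show ?thesis using inv_f_f[OF inj, of y] by simp
      qed
    qed
    with Suc show ?thesis by simp
  qed
qed

section \<open>Moment bounds for the two theta-Milstein approximations\<close>

theorem theorem3p1:
  fixes f g :: "real ^ 'n \<Rightarrow> real ^ 'n"
    and \<mu> c \<sigma> \<beta> \<theta> T p :: real
    and x0 :: "real ^ 'n"
    and M :: "'a measure" and F :: "real \<Rightarrow> 'a measure" and w :: "real \<Rightarrow> 'a \<Rightarrow> real"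
  assumes "brownian_motion M F w"
    and "class_C2 f" and "class_C2 g"
    and "c > 0"
    and "\<And>x y. (x - y) \<bullet> (f x - f y) \<le> \<mu> * (norm (x - y))\<^sup>2"
    and "\<And>x y. (norm (g x - g y))\<^sup>2 \<le> c * (norm (x - y))\<^sup>2"
    and "\<And>x y. (norm (L1 g g x - L1 g g y))\<^sup>2 \<le> \<sigma> * (norm (x - y))\<^sup>2"
    and "\<beta> = max (\<mu> + 1/2) (2 * c)"
    and "\<theta> \<in> {1/2..1}" and "T > 0"
    and "p \<ge> 2"
  shows "\<exists>C>0. \<forall>N::nat. \<forall>\<Delta>::real. N > 0 \<longrightarrow> \<Delta> = T / real N \<longrightarrow> \<Delta> < 1 / (2 * \<theta> * \<beta>) \<longrightarrow>
    (integrable M (\<lambda>\<omega>. SUP k\<in>{k. real k * \<Delta> \<in> {0..T}}. norm (sstm f g \<theta> w x0 \<Delta> k \<omega>) powr p) \<and>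
     (\<integral>\<omega>. (SUP k\<in>{k. real k * \<Delta> \<in> {0..T}}. norm (sstm f g \<theta> w x0 \<Delta> k \<omega>) powr p) \<partial>M) \<le> C) \<and>
    (integrable M (\<lambda>\<omega>. SUP k\<in>{k. real k * \<Delta> \<in> {0..T}}. norm (stm f g \<theta> w x0 \<Delta> k \<omega>) powr p) \<and>
     (\<integral>\<omega>. (SUP k\<in>{k. real k * \<Delta> \<in> {0..T}}. norm (stm f g \<theta> w x0 \<Delta> k \<omega>) powr p) \<partial>M) \<le> C)"
proof -
  interpret brownian_motion M F w by fact
  note f_mono = assms(5) and g_lip = assms(6) and L1_lip = assms(7)
  have \<theta>: "1/2 \<le> \<theta>" "\<theta> \<le> 1" and T: "0 < T" and p: "2 \<le> p"
    using assms by auto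
  have \<beta>: "\<mu> + 1/2 \<le> \<beta>" "0 < \<beta>"
    using assms(4,8) by auto
  have contf: "continuous_on UNIV f"
  proof -
    obtain f' where "\<And>x. (f has_derivative blinfun_apply (f' x)) (at x)"
      using assms(2) unfolding class_C2_def by blast
    then show ?thesis
      by (intro continuous_at_imp_continuous_on ballI) (rule has_derivative_continuous)
  qed
  have contg: "continuous_on UNIV g" and contl: "continuous_on UNIV (L1 g g)"
    using sq_Lipschitz_continuous[of g c] sq_Lipschitz_continuous[of "L1 g g" \<sigma>] g_lip L1_lip by blast+
  define q where "q = nat \<lceil>p / 2\<rceil>"
  have pq: "p / 2 \<le> real q" unfolding q_def by linarith
  \<comment> \<open>\<open>B\<close> is the linear growth constant of \<open>H\<close>, and
    \<open>D\<close>, \<open>Gg\<close>, \<open>\<Lambda>\<close> are those of drift, diffusion and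
    Milstein correction as functions of \<open>z\<close>. All use \<open>T\<close> as an upper bound
    for the stepsize, so none depends on it.\<close>
  define B where "B = 2 + 2 * T * norm (f 0)"
  define D where "D = 2 * \<beta> * B\<^sup>2 + (norm (f 0))\<^sup>2"
  define Gg where "Gg = norm (g 0) + sqrt \<bar>c\<bar> * B"
  define \<Lambda> where "\<Lambda> = norm (L1 g g 0) + sqrt \<bar>\<sigma>\<bar> * B"
  define K where "K = D + 2 * (1 + T * D) * Gg + (1 + T * D) * \<Lambda> + 2 * Gg\<^sup>2 + T * \<Lambda>\<^sup>2"
  define A where "A = real (2 * q) * K + (K * (1 + sqrt T))\<^sup>2 * (real (2 * q))\<^sup>2 * (1 + sqrt T * (K * (1 + sqrt T))) ^ (2 * q)"
  define E where "E = exp (T * (A * (\<integral>x. std_normal_density x * (1 + x^4) ^ (2 * q + 2) \<partial>lborel)))"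
  \<comment> \<open>\<open>norm x0 + T * norm (f x0)\<close> bounds the initial value of the
    split-step chain for every admissible stepsize.\<close>
  define C0 where "C0 = E * (2 * (1 + (norm x0 + T * norm (f x0))\<^sup>2) ^ q)"
  \<comment> \<open>The factor \<open>B powr p\<close> pays for passing from \<open>z\<close> to
    \<open>y\<close>; as it is at least 1, \<open>C\<close> serves both approximations.\<close>
  define C where "C = B powr p * C0"
  have B1: "1 \<le> B" using T by (simp add: B_def)
  have nonneg: "0 \<le> D" "0 \<le> Gg" "0 \<le> \<Lambda>"
    using \<beta> B1 by (auto simp: D_def Gg_def \<Lambda>_def)
  have C0: "0 < C0"
    unfolding C0_def E_def by (intro mult_pos_pos exp_gt_zero zero_less_power add_pos_nonneg) auto
  have Bp: "1 \<le> B powr p" using B1 p by (simp add: ge_one_powr_ge_zero)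
  then have C: "C0 \<le> C"
    using C0 mult_right_mono[of 1 "B powr p" C0] by (simp add: C_def)
  with C0 have C_pos: "0 < C" by linarith
  show ?thesis
  proof (intro exI[of _ C] conjI[OF C_pos] allI impI)
    fix N :: nat and \<Delta> :: real
    assume N: "0 < N" and \<Delta>: "\<Delta> = T / real N" and small: "\<Delta> < 1 / (2 * \<theta> * \<beta>)"
    have d: "0 < \<Delta>" "real N * \<Delta> = T" using N \<Delta> T by auto
    have dT: "\<Delta> \<le> T"
      using d N mult_right_mono[of 1 "real N" \<Delta>] by simp
    define h where "h = \<theta> * \<Delta>"
    have h0: "0 \<le> h" using \<theta> d by (simp add: h_def)
    have hT: "h \<le> T"
      using \<theta> d dT mult_mono[of \<theta> 1 \<Delta> T] by (simp add: h_def)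
    \<comment> \<open>This is the stepsize restriction; with \<open>\<mu> \<le> \<beta>\<close> it
      yields the condition on the resolvent.\<close>
    have "h * \<beta> < 1/2"
      using small \<theta> \<beta> by (simp add: h_def field_simps)
    moreover have "h * \<mu> \<le> h * \<beta>"
      using h0 \<beta> by (intro mult_left_mono) auto
    ultimately have h\<mu>: "h * \<mu> \<le> 1/2" by linarith
    let ?G = "\<lambda>x. x - h *\<^sub>R f x"
    define H where "H = inv ?G"
    have GH: "H z - h *\<^sub>R f (H z) = z" for z
      using surj_f_inv_f[OF one_sided_Lipschitz_resolvent_surj[OF f_mono h0 h\<mu> contf], of z]
      by (simp add: H_def)
    have H_expand: "norm (H z - y) \<le> 2 * norm (z - (y - h *\<^sub>R f y))" for z y
      using one_sided_Lipschitz_resolvent_expanding[OF f_mono h0 h\<mu>, of "H z" y] by (simp add: GH)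
    \<comment> \<open>Taking \<open>y\<close> in the range of \<open>H\<close> turns the expansion
      estimate into the Lipschitz bound 2 for \<open>H\<close>.\<close>
    have contH: "continuous_on UNIV H"
      using H_expand[of _ "H _"] unfolding GH
      by (intro lipschitz_on_continuous_on[of 2] lipschitz_onI) (auto simp: dist_norm)
    have H_le: "norm (H z) \<le> B * sqrt (1 + (norm z)\<^sup>2)" for z
    proof -
      have "norm (H z) \<le> 2 * norm (z + h *\<^sub>R f 0)"
        using H_expand[of z 0] by simp
      also have "\<dots> \<le> 2 * (norm z + T * norm (f 0))"
        using h0 hT by (intro mult_left_mono order_trans[OF norm_triangle_ineq] add_left_mono)
          (auto intro: mult_right_mono)
      also have "\<dots> \<le> 2 * (sqrt (1 + (norm z)\<^sup>2) + T * norm (f 0) * sqrt (1 + (norm z)\<^sup>2))"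
        using T mult_left_mono[of 1 "sqrt (1 + (norm z)\<^sup>2)" "T * norm (f 0)"]
        by (intro mult_left_mono add_mono real_le_rsqrt) auto
      finally show ?thesis by (simp add: B_def algebra_simps)
    qed
    define \<Psi> where "\<Psi> = (\<lambda>z x. z + \<Delta> *\<^sub>R f (H z) + x *\<^sub>R g (H z) + ((x\<^sup>2 - \<Delta>) / 2) *\<^sub>R L1 g g (H z))"
    have growth: "\<exists>a. \<bar>a\<bar> \<le> K \<and> (\<forall>\<eta>. 1 + (norm (\<Psi> z (sqrt \<Delta> * \<eta>)))\<^sup>2
      \<le> (1 + (norm z)\<^sup>2) * (1 + a * sqrt \<Delta> * \<eta> + K * (sqrt \<Delta>)\<^sup>2 * (1 + \<eta>^4)))" for z
    proof -
      let ?v = "sqrt (1 + (norm z)\<^sup>2)"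
      let ?y = "H z"
      have v1: "1 \<le> ?v" by simp
      \<comment> \<open>The \<open>1/2\<close> in \<open>\<mu> + 1/2 \<le> \<beta>\<close> pays for
        the square of \<open>?y\<close> produced by Young's inequality on
        \<open>?y \<bullet> f 0\<close>.\<close>
      have "2 * (?y \<bullet> f ?y) \<le> 2 * \<beta> * (norm ?y)\<^sup>2 + (norm (f 0))\<^sup>2"
      proof -
        have "?y \<bullet> f ?y = (?y - 0) \<bullet> (f ?y - f 0) + ?y \<bullet> f 0" by (simp add: inner_diff_right)
        moreover have "(?y - 0) \<bullet> (f ?y - f 0) \<le> \<mu> * (norm ?y)\<^sup>2" using f_mono[of ?y 0] by simp
        moreover have "2 * (?y \<bullet> f 0) \<le> (norm ?y)\<^sup>2 + (norm (f 0))\<^sup>2"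
          using zero_le_power2[of "norm (?y - f 0)"]
          unfolding power2_norm_eq_inner by (simp add: algebra_simps inner_commute)
        moreover have "(\<mu> + 1/2) * (norm ?y)\<^sup>2 \<le> \<beta> * (norm ?y)\<^sup>2"
          using \<beta> by (intro mult_right_mono) auto
        ultimately show ?thesis by (simp add: algebra_simps)
      qed
      also have "(norm ?y)\<^sup>2 \<le> B\<^sup>2 * (1 + (norm z)\<^sup>2)"
        using power_mono[OF H_le[of z], of 2] by (simp add: power_mult_distrib)
      also have "(norm (f 0))\<^sup>2 \<le> (norm (f 0))\<^sup>2 * (1 + (norm z)\<^sup>2)"
        by (simp add: algebra_simps)
      finally have D: "2 * (?y \<bullet> f ?y) \<le> D * (1 + (norm z)\<^sup>2)"
        using \<beta> by (simp add: D_def algebra_simps)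
      \<comment> \<open>The one-step estimate is used with \<open>s = sqrt \<Delta>\<close>, the
        standard deviation of the Brownian increment.\<close>
      have s: "0 \<le> sqrt \<Delta>" "(sqrt \<Delta>)\<^sup>2 \<le> T" using d dT by auto
      have z: "z = ?y - (\<theta> * (sqrt \<Delta>)\<^sup>2) *\<^sub>R f ?y"
        using GH[of z] d by (simp add: h_def)
      show ?thesis
        using milstein_step_growth[OF \<theta>(1) s z nonneg D
            sq_Lipschitz_growth[OF g_lip H_le v1, folded Gg_def]
            sq_Lipschitz_growth[OF L1_lip H_le v1, folded \<Lambda>_def] K_def] d
        by (simp add: \<Psi>_def)
    qed
    have \<Psi>_meas: "case_prod \<Psi> \<in> borel_measurable (borel \<Otimes>\<^sub>M borel)"
    proof -
      have [measurable]: "H \<in> borel_measurable borel" "f \<in> borel_measurable borel"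
        "g \<in> borel_measurable borel" "L1 g g \<in> borel_measurable borel"
        using contH contf contg contl by (auto intro: borel_measurable_continuous_onI)
      show ?thesis unfolding \<Psi>_def case_prod_beta by measurable
    qed
    let ?Z = "sstm f g \<theta> w x0 \<Delta>" and ?Y = "stm f g \<theta> w x0 \<Delta>"
    have YH: "?Y k \<omega> = H (?Z k \<omega>)" for k \<omega>
      using stm_resolvent[OF f_mono, of \<theta> \<Delta>] h0 h\<mu> contf by (simp add: H_def h_def)
    have Z_Suc: "?Z (Suc k) \<omega> = \<Psi> (?Z k \<omega>) (w (real (k + 1) * \<Delta>) \<omega> - w (real k * \<Delta>) \<omega>)" for k \<omega>
      unfolding \<Psi>_def by (simp add: Let_def YH)
    have Z0: "?Z 0 \<omega> = ?G x0" for \<omega> by (simp add: h_def)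
    define R where "R = (\<lambda>\<omega>. sqrt (running_max (\<lambda>k \<omega>. (1 + (norm (?Z k \<omega>))\<^sup>2) ^ (2 * q)) N \<omega>))"
    note main = markov_chain_running_max_le[OF d N \<Psi>_meas Z0 Z_Suc growth A_def]
    have Z_meas: "?Z k \<in> borel_measurable M" for k by (rule main(1))
    have Y_meas: "?Y k \<in> borel_measurable M" for k
    proof -
      have "H \<in> borel_measurable borel" using contH by (rule borel_measurable_continuous_onI)
      from measurable_compose[OF Z_meas[of k] this] show ?thesis by (simp add: YH[abs_def])
    qed
    have R_le: "(\<integral>\<^sup>+\<omega>. ennreal (R \<omega>) \<partial>M) \<le> ennreal C0"
    proof -
      have "norm (?G x0) \<le> norm x0 + T * norm (f x0)"
        using h0 hT by (intro order_trans[OF norm_triangle_ineq4] add_left_mono) (auto intro: mult_right_mono)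
      then have "E * (2 * (1 + (norm (?G x0))\<^sup>2) ^ q) \<le> C0"
        unfolding C0_def E_def by (intro mult_left_mono power_mono add_left_mono) auto
      with main(2) show ?thesis
        unfolding R_def E_def by (meson ennreal_leI order_trans)
    qed
    have V_le: "(1 + (norm (?Z k \<omega>))\<^sup>2) powr (p / 2) \<le> R \<omega>" if "k \<le> N" for k \<omega>
    proof -
      let ?V = "1 + (norm (?Z k \<omega>))\<^sup>2"
      have V: "0 < ?V" by (simp add: add_pos_nonneg)
      have "?V powr (p / 2) \<le> ?V powr real q" using pq by (intro powr_mono) auto
      also have "\<dots> = ?V ^ q" using V by (rule powr_realpow)
      also have "\<dots> = sqrt (?V ^ (2 * q))"
        by (simp only: power_even_eq real_sqrt_abs) simp
      also have "\<dots> \<le> R \<omega>"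
        unfolding R_def
        using running_max_ge[OF that, of "\<lambda>k \<omega>. (1 + (norm (?Z k \<omega>))\<^sup>2) ^ (2 * q)" \<omega>] by simp
      finally show ?thesis .
    qed
    have sqrt_powr: "sqrt v powr p = v powr (p / 2)" if "0 < v" for v :: real
      using that by (simp add: powr_half_sqrt[symmetric] powr_powr)
    have Z_le: "norm (?Z k \<omega>) powr p \<le> R \<omega>" if "k \<le> N" for k \<omega>
    proof -
      have "norm (?Z k \<omega>) powr p \<le> sqrt (1 + (norm (?Z k \<omega>))\<^sup>2) powr p"
        using p by (intro powr_mono2 real_le_rsqrt) auto
      also have "\<dots> \<le> R \<omega>"
        using V_le[OF that] by (subst sqrt_powr) (auto simp: add_pos_nonneg)
      finally show ?thesis .
    qed
    have Y_le: "norm (?Y k \<omega>) powr p \<le> B powr p * R \<omega>" if "k \<le> N" for k \<omega>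
    proof -
      have "norm (?Y k \<omega>) powr p \<le> (B * sqrt (1 + (norm (?Z k \<omega>))\<^sup>2)) powr p"
        using p H_le[of "?Z k \<omega>"] by (intro powr_mono2) (auto simp: YH)
      also have "\<dots> = B powr p * sqrt (1 + (norm (?Z k \<omega>))\<^sup>2) powr p"
        using B1 by (simp add: powr_mult)
      also have "\<dots> \<le> B powr p * R \<omega>"
        using V_le[OF that] by (subst sqrt_powr) (auto simp: add_pos_nonneg intro: mult_left_mono)
      finally show ?thesis .
    qed
    have BR_le: "(\<integral>\<^sup>+\<omega>. ennreal (B powr p * R \<omega>) \<partial>M) \<le> ennreal C"
    proof -
      have "running_max (\<lambda>k \<omega>. (1 + (norm (?Z k \<omega>))\<^sup>2) ^ (2 * q)) N \<in> borel_measurable M"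
        using Z_meas by (intro borel_measurable_running_max) measurable
      then have "R \<in> borel_measurable M"
        unfolding R_def by measurable
      then have "(\<integral>\<^sup>+\<omega>. ennreal (B powr p * R \<omega>) \<partial>M) = ennreal (B powr p) * (\<integral>\<^sup>+\<omega>. ennreal (R \<omega>) \<partial>M)"
        by (simp add: ennreal_mult' nn_integral_cmult)
      also have "\<dots> \<le> ennreal (B powr p) * ennreal C0"
        by (intro mult_left_mono R_le) simp
      finally show ?thesis using C0 by (simp add: C_def ennreal_mult)
    qed
    \<comment> \<open>Because \<open>N * \<Delta> = T\<close>, the index \<open>N\<close> of the
      endpoint is included and the supremum runs over a finite set.\<close>
    have I: "{k. real k * \<Delta> \<in> {0..T}} = {..N}"
      using d(1) unfolding d(2)[symmetric] by auto
    have CR_le: "(\<integral>\<^sup>+\<omega>. ennreal (R \<omega>) \<partial>M) \<le> ennreal C"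
      using R_le C by (meson ennreal_leI order_trans)
    show "(integrable M (\<lambda>\<omega>. SUP k\<in>{k. real k * \<Delta> \<in> {0..T}}. norm (?Z k \<omega>) powr p) \<and>
        (\<integral>\<omega>. (SUP k\<in>{k. real k * \<Delta> \<in> {0..T}}. norm (?Z k \<omega>) powr p) \<partial>M) \<le> C) \<and>
      (integrable M (\<lambda>\<omega>. SUP k\<in>{k. real k * \<Delta> \<in> {0..T}}. norm (?Y k \<omega>) powr p) \<and>
        (\<integral>\<omega>. (SUP k\<in>{k. real k * \<Delta> \<in> {0..T}}. norm (?Y k \<omega>) powr p) \<partial>M) \<le> C)"
      unfolding I using Z_meas Y_meas Z_le Y_le CR_le BR_le C_pos
      by (intro conjI[OF integrable_SUP_bounded[where R = R] integrable_SUP_bounded[where R = "\<lambda>\<omega>. B powr p * R \<omega>"]]) auto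
  qed
qed

end
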